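(* There exist $M\in\mathbb{N}$ and a nonempty set $A\subset\mathbb{Z}_M$ such that $A$ satisfies both (T1) and (T2), $M$ has four distinct prime divisors, and $A(X)$ has at least one unsupported cyclotomic divisor.
   Context: $\mathbb{Z}_M=\mathbb{Z}/M\mathbb{Z}$. For $A\subset\mathbb{Z}_M$, represent its elements by integers in $\{0,1,\dots,M-1\}$; the mask polynomial is $A(X)=\sum_{a\in A}X^a$, considered modulo $X^M-1$. For $s\mid M$, divisibility of $A(X)$ by the $s$-th cyclotomic polynomial $\Phi_s(X)$ is well defined, since $\Phi_s\mid X^M-1$; all cyclotomic divisors $\Phi_s$ considered have $s\mid M$. "$M$ has four distinct prime divisors" means exactly four. $S_A^*$ is the set of all prime powers $p^\alpha>1$ (with $p^\alpha\mid M$) such that $\Phi_{p^\alpha}(X)\mid A(X)$. Conditions: (T1) $|A|=\prod_{s\in S_A^*}\Phi_s(1)$; (T2) if $s_1,\dots,s_k\in S_A^*$ are powers of distinct primes, then $\Phi_{s_1\cdots s_k}(X)$ divides $A(X)$. If $s\neq1$ and $\Phi_s\mid A$, then $\Phi_s$ is called an unsupported divisor of $A$ if (i) for every prime $p\mid s$ we have $p\mid |A|$, and (ii) for every prime power $p^\alpha$ with $p^\alpha\parallel s$ (i.e. $p$ is a prime dividing $s$, $p^\alpha\mid s$ and $p^{\alpha+1}\nmid s$), we have $\Phi_{p^\alpha}\nmid A$. *)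

theory Defs
  imports Complex_Main
    "HOL-Computational_Algebra.Polynomial"
    "HOL-Number_Theory.Prime_Powers"
begin

text \<open>
  All polynomials are taken over the complex numbers. The mask polynomial and the cyclotomic
  polynomials have integer coefficients and the latter are monic, so divisibility over the
  complex numbers and over the integers coincide.
\<close>

definition cyclotomic :: "nat \<Rightarrow> complex poly" where
  "cyclotomic n = (\<Prod>k | k \<in> {1..n} \<and> coprime k n. [:- cis (2 * pi * real k / real n), 1:])"

text \<open>
  A subset of the integers modulo \<open>M\<close> is represented by the set \<open>A \<subseteq> {..<M}\<close> of least
  nonnegative representatives. The mask polynomial is the resulting representative of its class
  modulo \<open>X ^ M - 1\<close>; this is harmless because only divisors \<open>cyclotomic s\<close> with \<open>s dvd M\<close>
  are considered.
\<close>

definition mask_poly :: "nat set \<Rightarrow> complex poly" where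
  "mask_poly A = (\<Sum>a\<in>A. monom 1 a)"

definition prime_power_divisors :: "nat \<Rightarrow> nat set \<Rightarrow> nat set" where
  "prime_power_divisors M A = {s. primepow s \<and> s dvd M \<and> cyclotomic s dvd mask_poly A}"

definition T1 :: "nat \<Rightarrow> nat set \<Rightarrow> bool" where
  "T1 M A \<longleftrightarrow> of_nat (card A) = (\<Prod>s\<in>prime_power_divisors M A. poly (cyclotomic s) 1)"

text \<open>
  The prime powers \<open>s\<^sub>1, \<dots>, s\<^sub>k\<close> of distinct primes, with \<open>k \<ge> 1\<close>, are given by the nonempty set \<open>P\<close>
  of their primes and the exponent function \<open>e\<close>.
\<close>

definition T2 :: "nat \<Rightarrow> nat set \<Rightarrow> bool" where
  "T2 M A \<longleftrightarrow>
     (\<forall>(P :: nat set) (e :: nat \<Rightarrow> nat).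
        finite P \<and> P \<noteq> {} \<and> (\<forall>p\<in>P. prime p \<and> p ^ e p \<in> prime_power_divisors M A) \<longrightarrow>
        cyclotomic (\<Prod>p\<in>P. p ^ e p) dvd mask_poly A)"

definition unsupported_divisor :: "nat \<Rightarrow> nat set \<Rightarrow> nat \<Rightarrow> bool" where
  "unsupported_divisor M A s \<longleftrightarrow>
     s dvd M \<and> s \<noteq> 1 \<and> cyclotomic s dvd mask_poly A \<and>
     (\<forall>p. prime p \<and> p dvd s \<longrightarrow> p dvd card A) \<and>
     (\<forall>p \<alpha>. prime p \<and> p dvd s \<and> p ^ \<alpha> dvd s \<and> \<not> p ^ (\<alpha> + 1) dvd s \<longrightarrow>
        \<not> cyclotomic (p ^ \<alpha>) dvd mask_poly A)"

end

theory Submission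
  imports Defs
begin

text \<open>
  Take \<open>M = 1260\<close> and \<open>A = {0,\<dots>,5} + {0, 12, 18, 24, 36}\<close>. Since
  \<open>1 + Y\<^sup>2 + Y\<^sup>3 + Y\<^sup>4 + Y\<^sup>6 = \<Phi>\<^sub>5(Y) \<Phi>\<^sub>6(Y)\<close>, the mask polynomial is
  \<open>\<Phi>\<^sub>2 \<Phi>\<^sub>3 \<Phi>\<^sub>6 (X) \<Phi>\<^sub>5(X\<^sup>6) \<Phi>\<^sub>6(X\<^sup>6)\<close>. The first four factors are the product of the \<open>\<Phi>\<^sub>d\<close> with
  \<open>d dvd 30\<close> and \<open>d \<noteq> 1\<close>, which gives (T1) and (T2) with \<open>S\<^sub>A\<^sup>* = {2, 3, 5}\<close>, and the last one is
  \<open>\<Phi>\<^bsub>36\<^esub>\<close>, which is unsupported because \<open>\<Phi>\<^sub>4\<close> and \<open>\<Phi>\<^sub>9\<close> do not divide \<open>A\<close>. The prime \<open>7\<close> only serves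
  to give \<open>M\<close> a fourth prime factor.
\<close>

section \<open>Roots of unity and divisibility by cyclotomic polynomials\<close>

text \<open>Order exactly \<open>n\<close> as one equivalence, so that each \<open>z ^ d = 1\<close>
  with a numeral \<open>d\<close> is decided by simplification.\<close>

definition primitive_root_of_unity :: "nat \<Rightarrow> 'a :: monoid_mult \<Rightarrow> bool" where
  "primitive_root_of_unity n z \<longleftrightarrow> (\<forall>d. z ^ d = 1 \<longleftrightarrow> n dvd d)"

text \<open>By De Moivre the power is the root with index \<open>k * d\<close>, which depends only
  on the residue modulo \<open>n\<close>; distinct residues give distinct roots.\<close>

lemma cis_root_power_eq_1_iff:
  assumes "n > 0"
  shows "cis (2 * pi * real k / real n) ^ d = 1 \<longleftrightarrow> n dvd k * d"
proof -
  let ?f = "\<lambda>k. cis (2 * pi * real k / real n)"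
  have inj: "inj_on ?f {..<n}"
    using bij_betw_roots_unity[OF assms] by (simp add: bij_betw_def)
  have period: "?f (n * q + r) = ?f r" for q r
  proof -
    have "2 * pi * real (n * q + r) / real n = 2 * pi * real q + 2 * pi * real r / real n"
      using assms by (simp add: field_simps)
    moreover have "cis (2 * pi * real q) = 1"
      by (intro cis_multiple_2pi) auto
    ultimately show ?thesis
      by (simp flip: cis_mult)
  qed
  have "?f k ^ d = ?f (k * d)"
    by (simp add: DeMoivre algebra_simps)
  also have "\<dots> = ?f (k * d mod n)"
    using period[of "k * d div n" "k * d mod n"] by simp
  finally have "?f k ^ d = 1 \<longleftrightarrow> ?f (k * d mod n) = ?f 0"
    by simp
  also have "\<dots> \<longleftrightarrow> k * d mod n = 0"
    using inj_on_eq_iff[OF inj, of "k * d mod n" 0] assms by simp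
  finally show ?thesis
    by (simp add: dvd_eq_mod_eq_0)
qed

lemma primitive_root_of_unity_cis:
  assumes "n > 0" "coprime k n"
  shows "primitive_root_of_unity n (cis (2 * pi * real k / real n))"
  using assms by (simp add: primitive_root_of_unity_def cis_root_power_eq_1_iff
      coprime_dvd_mult_right_iff coprime_commute)

text \<open>Distinct roots split off one at a time: in an integral domain the remaining ones are
  still roots of the quotient.\<close>

lemma prod_linear_factors_dvd:
  fixes p :: "'a :: idom poly"
  assumes "finite K" "inj_on f K" "\<And>k. k \<in> K \<Longrightarrow> poly p (f k) = 0"
  shows "(\<Prod>k\<in>K. [:- f k, 1:]) dvd p"
  using assms
proof (induction K arbitrary: p rule: finite_induct)
  case (insert k K)
  obtain q where q: "p = [:- f k, 1:] * q"
    using insert.prems(2)[of k] by (auto simp: poly_eq_0_iff_dvd)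
  have "poly q (f j) = 0" if "j \<in> K" for j
  proof -
    have "f j \<noteq> f k"
      using insert.prems(1) insert.hyps(2) that by (metis inj_onD insertI1 insertI2)
    moreover have "poly p (f j) = 0"
      using insert.prems(2) that by blast
    ultimately show ?thesis
      by (simp add: q)
  qed
  then have "(\<Prod>k\<in>K. [:- f k, 1:]) dvd q"
    using insert.IH insert.prems(1) by (simp add: inj_on_def)
  then show ?case
    unfolding q prod.insert[OF insert.hyps] by (rule mult_dvd_mono[OF dvd_refl])
qed simp

text \<open>The roots of \<open>cyclotomic n\<close> are simple and primitive, so vanishing at the
  primitive roots suffices.\<close>

lemma cyclotomic_dvdI:
  assumes "n > 0" "\<And>z. primitive_root_of_unity n z \<Longrightarrow> poly p z = 0"
  shows "cyclotomic n dvd p"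
proof -
  let ?f = "\<lambda>k. cis (2 * pi * real k / real n)"
  let ?K = "{k. k \<in> {1..n} \<and> coprime k n}"
  have inj: "inj_on ?f ?K"
  \<comment> \<open>\<open>k = n\<close> is coprime to \<open>n\<close> only for
    \<open>n = 1\<close>; otherwise the indices lie in \<open>{..<n}\<close>, where the roots are
    known to be distinct.\<close>
  proof (cases "n = 1")
    case True
    then show ?thesis by (auto simp: inj_on_def)
  next
    case False
    have "?K \<subseteq> {..<n}"
    proof
      fix k assume "k \<in> ?K"
      moreover from this have "k \<noteq> n" using False by auto
      ultimately show "k \<in> {..<n}" by auto
    qed
    with bij_betw_roots_unity[OF assms(1)] show ?thesis
      by (auto simp: bij_betw_def intro: inj_on_subset)
  qed
  have "(\<Prod>k\<in>?K. [:- ?f k, 1:]) dvd p"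
    using inj assms by (intro prod_linear_factors_dvd) (simp_all add: primitive_root_of_unity_cis)
  then show ?thesis
    by (simp add: cyclotomic_def)
qed

text \<open>Serves to refute divisibility: the order of the root obtained must yield the
  contradiction.\<close>

lemma cyclotomic_dvdE:
  assumes "n > 0" "cyclotomic n dvd p"
  obtains z where "primitive_root_of_unity n z" "poly p z = 0"
proof
  let ?z = "cis (2 * pi * real 1 / real n)"
  show "primitive_root_of_unity n ?z"
    by (rule primitive_root_of_unity_cis) (use assms in auto)
  have "[:- ?z, 1:] dvd cyclotomic n"
    unfolding cyclotomic_def by (rule dvd_prodI) (use assms in auto)
  then show "poly p ?z = 0"
    using assms(2) dvd_trans poly_eq_0_iff_dvd by blast
qed

text \<open>The geometric sum vanishes at all primitive \<open>p\<close>-th roots, so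
  \<open>cyclotomic p\<close> divides it; both are monic of degree \<open>p - 1\<close>, so the
  cofactor is 1.\<close>

lemma cyclotomic_prime:
  assumes "prime p"
  shows "cyclotomic p = (\<Sum>i<p. monom 1 i)"
proof -
  let ?q = "\<Sum>i<p. monom (1 :: complex) i"
  have p: "p > 1" using assms prime_gt_1_nat by blast
  have "cyclotomic p dvd ?q"
  proof (rule cyclotomic_dvdI)
    fix z :: complex assume z: "primitive_root_of_unity p z"
    have "z ^ p = 1" "z \<noteq> 1"
      using z p by (auto simp: primitive_root_of_unity_def dest: spec[of _ 1])
    then show "poly ?q z = 0"
      by (simp add: poly_sum poly_monom sum_gp_strict)
  qed (use p in auto)
  then obtain c where c: "?q = cyclotomic p * c" by (elim dvdE)
  have coeff: "coeff ?q i = (if i < p then 1 else 0)" for i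
    by (simp add: coeff_sum)
  have deg_q: "degree ?q = p - 1"
    by (rule antisym[OF degree_le le_degree]) (use p coeff in auto)
  have K: "{k. k \<in> {1..p} \<and> coprime k p} = {1..<p}"
  proof (intro equalityI subsetI)
    fix k assume k: "k \<in> {k. k \<in> {1..p} \<and> coprime k p}"
    then have "k \<noteq> p" using p by auto
    with k show "k \<in> {1..<p}" by auto
  next
    fix k assume "k \<in> {1..<p}"
    then have "\<not> p dvd k" using nat_dvd_not_less by auto
    then have "coprime p k" using assms prime_imp_coprime by blast
    then show "k \<in> {k. k \<in> {1..p} \<and> coprime k p}"
      using \<open>k \<in> {1..<p}\<close> by (auto simp: coprime_commute)
  qed
  have lc: "lead_coeff (cyclotomic p) = 1"
    by (simp add: cyclotomic_def lead_coeff_prod)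
  have deg: "degree (cyclotomic p) = p - 1"
    unfolding cyclotomic_def K by (subst degree_prod_eq_sum_degree) auto
  have "c \<noteq> 0" "cyclotomic p \<noteq> 0"
    using c deg_q p coeff[of 0] lc by auto
  then have "degree c = 0"
    using degree_mult_eq[of "cyclotomic p" c] c deg deg_q by simp
  moreover have "lead_coeff c = 1"
    using lead_coeff_mult[of "cyclotomic p" c] c[symmetric] lc coeff[of "p - 1"] p deg_q by simp
  ultimately have "c = 1"
    by (metis one_pCons degree_eq_zeroE coeff_pCons_0)
  then show ?thesis
    using c by simp
qed

lemma poly_cyclotomic_prime_1:
  assumes "prime p"
  shows "poly (cyclotomic p) 1 = of_nat p"
  by (simp add: cyclotomic_prime[OF assms] poly_sum poly_monom)

section \<open>The set and the factorisation of its mask polynomial\<close>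

definition example_set :: "nat set" where
  "example_set = (\<lambda>(i, j). i + j) ` ({..<6} \<times> {0, 12, 18, 24, 36})"

text \<open>The second summands are distinct multiples of 6, so \<open>i\<close> is the residue of
  \<open>i + j\<close> modulo 6.\<close>

lemma inj_on_example: "inj_on (\<lambda>(i, j). i + j :: nat) ({..<6} \<times> {0, 12, 18, 24, 36})"
  by (auto simp: inj_on_def)

lemma card_example_set: "card example_set = 30"
  unfolding example_set_def by (subst card_image[OF inj_on_example]) simp

lemma poly_mask_example_set:
  "poly (mask_poly example_set) z = (\<Sum>i<6. z ^ i) * (1 + z ^ 12 + z ^ 18 + z ^ 24 + z ^ 36)"
proof -
  have "poly (mask_poly example_set) z = (\<Sum>(i, j)\<in>{..<6} \<times> {0, 12, 18, 24, 36}. z ^ i * z ^ j)"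
    unfolding mask_poly_def example_set_def
    by (subst sum.reindex[OF inj_on_example])
      (simp add: poly_sum poly_monom case_prod_unfold power_add)
  also have "\<dots> = (\<Sum>i<6. z ^ i) * (\<Sum>j\<in>{0, 12, 18, 24, 36}. z ^ j)"
    by (simp only: sum_product sum.cartesian_product)
  finally show ?thesis
    by (simp add: add.assoc)
qed

section \<open>Cyclotomic divisors of the mask polynomial\<close>

lemma cyclotomic_dvd_mask_example_set:
  assumes "d dvd 30" "d \<noteq> 1"
  shows "cyclotomic d dvd mask_poly example_set"
proof (rule cyclotomic_dvdI)
  show "d > 0" using assms by (auto intro: Nat.gr0I)
next
  fix z :: complex assume z: "primitive_root_of_unity d z"
  then have "z ^ 30 = 1" "z \<noteq> 1"
    using assms by (auto simp: primitive_root_of_unity_def dest: spec[of _ 1])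
  show "poly (mask_poly example_set) z = 0"
  proof (cases "z ^ 6 = 1")
    case True
    then have "(\<Sum>i<6. z ^ i) = 0"
      using \<open>z \<noteq> 1\<close> by (simp add: sum_gp_strict)
    then show ?thesis
      by (simp add: poly_mask_example_set)
  next
    case False
    define w where "w = z ^ 6"
    have w: "w ^ 5 = 1" "w \<noteq> 1"
      using \<open>z ^ 30 = 1\<close> False by (simp_all add: w_def flip: power_mult)
    \<comment> \<open>This turns the exponents 0, 2, 3, 4, 6 of \<open>w\<close> into 0 to 4, a full
      geometric sum.\<close>
    have "w ^ 6 = w"
      using w(1) power_add[of w 5 1] by simp
    then have "1 + z ^ 12 + z ^ 18 + z ^ 24 + z ^ 36 = 1 + w ^ 2 + w ^ 3 + w ^ 4 + w"
      by (simp add: w_def flip: power_mult)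
    also have "\<dots> = (\<Sum>i<5. w ^ i)"
      by (simp add: eval_nat_numeral)
    also have "\<dots> = 0"
      using w by (simp add: sum_gp_strict)
    finally show ?thesis
      by (simp add: poly_mask_example_set)
  qed
qed

lemma cyclotomic_36_dvd_mask_example_set: "cyclotomic 36 dvd mask_poly example_set"
proof (rule cyclotomic_dvdI)
  fix z :: complex assume z: "primitive_root_of_unity 36 z"
  define w where "w = z ^ 6"
  have w: "w ^ 6 = 1" "w ^ 3 \<noteq> 1" "w ^ 2 \<noteq> 1"
    using z by (auto simp: primitive_root_of_unity_def w_def simp flip: power_mult)
  \<comment> \<open>\<open>w\<close> has order 6: the factors \<open>w ^ 3 - 1\<close> and
    \<open>w + 1\<close> of \<open>w ^ 6 - 1\<close> are nonzero, which leaves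
    \<open>1 - w + w ^ 2\<close>.\<close>
  have "(w ^ 3 - 1) * (w ^ 3 + 1) = 0"
    using w(1) by (simp add: algebra_simps flip: power_add)
  then have "w ^ 3 = -1"
    using w(2) by (simp add: eq_neg_iff_add_eq_0)
  then have "(w + 1) * (1 - w + w ^ 2) = 0"
    by (simp add: algebra_simps eval_nat_numeral)
  moreover have "w + 1 \<noteq> 0"
    using w(3) by (auto simp flip: eq_neg_iff_add_eq_0)
  ultimately have *: "1 - w + w ^ 2 = 0"
    by simp
  have "1 + z ^ 12 + z ^ 18 + z ^ 24 + z ^ 36 = 1 + w ^ 2 + w ^ 3 + w ^ 4 + w ^ 6"
    by (simp add: w_def flip: power_mult)
  also have "\<dots> = (1 + w + w ^ 2 + w ^ 3 + w ^ 4) * (1 - w + w ^ 2)"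
    by (simp add: algebra_simps eval_nat_numeral)
  finally show "poly (mask_poly example_set) z = 0"
    by (simp add: poly_mask_example_set *)
qed auto

section \<open>Prime powers whose cyclotomic polynomials do not divide the mask polynomial\<close>

lemma not_cyclotomic_4_dvd_mask_example_set: "\<not> cyclotomic 4 dvd mask_poly example_set"
proof
  assume "cyclotomic 4 dvd mask_poly example_set"
  then obtain z where z: "primitive_root_of_unity 4 z" and 0: "poly (mask_poly example_set) z = 0"
    by (rule cyclotomic_dvdE[rotated]) auto
  have z4: "z ^ 4 = 1" and z2: "z ^ 2 \<noteq> 1"
    using z by (auto simp: primitive_root_of_unity_def)
  have "(z ^ 2 - 1) * (z ^ 2 + 1) = 0"
    using z4 by (simp add: algebra_simps flip: power_add)
  then have sq: "z ^ 2 = -1"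
    using z2 by (simp add: eq_neg_iff_add_eq_0)
  have "z ^ (2 * k) = (-1) ^ k" for k
    by (simp add: power_mult sq)
  \<comment> \<open>The five terms become 1 + 1 - 1 + 1 + 1.\<close>
  from this[of 6] this[of 9] this[of 12] this[of 18]
  have "1 + z ^ 12 + z ^ 18 + z ^ 24 + z ^ 36 = 3"
    by simp
  moreover have "(\<Sum>i<6. z ^ i) = (1 + z) * (1 + z ^ 2 + z ^ 4)"
    by (simp add: algebra_simps eval_nat_numeral)
  ultimately have "(1 + z) * (1 + z ^ 2 + z ^ 4) * 3 = 0"
    using 0 by (simp only: poly_mask_example_set)
  then have "1 + z = 0"
    unfolding mult_eq_0_iff by (simp add: sq z4)
  then have "z = -1"
    by (metis add.commute eq_neg_iff_add_eq_0)
  with z2 show False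
    by simp
qed

lemma not_cyclotomic_9_dvd_mask_example_set: "\<not> cyclotomic 9 dvd mask_poly example_set"
proof
  assume "cyclotomic 9 dvd mask_poly example_set"
  then obtain z where z: "primitive_root_of_unity 9 z" and 0: "poly (mask_poly example_set) z = 0"
    by (rule cyclotomic_dvdE[rotated]) auto
  have z9: "z ^ 9 = 1" and z3: "z ^ 3 \<noteq> 1" and z6: "z ^ 6 \<noteq> 1" and z1: "z \<noteq> 1"
    using z by (auto simp: primitive_root_of_unity_def dest: spec[of _ 1])
  have "z ^ 18 = 1" "z ^ 36 = 1"
    using z by (auto simp: primitive_root_of_unity_def)
  moreover have "z ^ 12 = z ^ 3" "z ^ 24 = z ^ 6"
    using power_add[of z 9 3] power_add[of z 18 6] z9 \<open>z ^ 18 = 1\<close> by simp_all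
  moreover have "1 + z ^ 3 + z ^ 6 = 0"
  proof -
    have "(z ^ 3 - 1) * (1 + z ^ 3 + z ^ 6) = 0"
      using z9 by (simp add: algebra_simps flip: power_add)
    with z3 show ?thesis by simp
  qed
  \<comment> \<open>Modulo 9 the exponents are 0, 3, 0, 6, 0; removing the vanishing
    \<open>1 + z ^ 3 + z ^ 6\<close> leaves two ones.\<close>
  ultimately have "1 + z ^ 12 + z ^ 18 + z ^ 24 + z ^ 36 = 2"
    by (simp add: algebra_simps)
  moreover have "(\<Sum>i<6. z ^ i) \<noteq> 0"
    using z1 z6 by (simp add: sum_gp_strict)
  ultimately show False
    using 0 by (simp only: poly_mask_example_set) simp
qed

text \<open>Since 7 divides 1260, it has to be kept out of the prime powers entering (T1).\<close>

lemma not_cyclotomic_7_dvd_mask_example_set: "\<not> cyclotomic 7 dvd mask_poly example_set"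
proof
  assume "cyclotomic 7 dvd mask_poly example_set"
  then obtain z where z: "primitive_root_of_unity 7 z" and 0: "poly (mask_poly example_set) z = 0"
    by (rule cyclotomic_dvdE[rotated]) auto
  have eq_1_iff: "z ^ d = 1 \<longleftrightarrow> 7 dvd d" for d
    using z by (simp add: primitive_root_of_unity_def)
  have z7: "z ^ 7 = 1" and z1: "z \<noteq> 1"
    using eq_1_iff[of 7] eq_1_iff[of 1] by simp_all
  have reduce: "z ^ (7 * q + r) = z ^ r" for q r
    by (simp add: power_add power_mult z7)
  have "(\<Sum>i<7. z ^ i) = 0"
    using z1 z7 by (simp add: sum_gp_strict)
  moreover have "1 + z ^ 12 + z ^ 18 + z ^ 24 + z ^ 36 = 1 + z ^ 5 + z ^ 4 + z ^ 3 + z"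
    using reduce[of 1 5] reduce[of 2 4] reduce[of 3 3] reduce[of 5 1] by simp
  moreover have "(\<Sum>i<6. z ^ i) \<noteq> 0"
    using z1 eq_1_iff[of 6] by (simp add: sum_gp_strict)
  \<comment> \<open>Modulo 7 the exponents are 0, 5, 4, 3, 1; subtracting from the vanishing sum
    over all residues leaves \<open>z ^ 2 + z ^ 6\<close>.\<close>
  ultimately have "z ^ 2 * (1 + z ^ 4) = 0"
    using 0 by (simp add: poly_mask_example_set eval_nat_numeral algebra_simps) algebra
  then have "z ^ 4 = -1"
    using z1 z7 by (auto simp: eq_neg_iff_add_eq_0 add.commute)
  then have "z ^ 8 = 1"
    using power_mult[of z 4 2] by simp
  then show False
    using eq_1_iff[of 8] by simp
qed

section \<open>Prime powers dividing 1260\<close>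

lemma prime_factors_1260: "prime_factors 1260 = {2, 3, 5, 7 :: nat}"
proof -
  \<comment> \<open>The nested form lets \<open>prime_factors_product\<close> peel off one prime at
    a time.\<close>
  have "prime_factors (2 * (2 * (3 * (3 * (5 * 7)))) :: nat) = {2, 3, 5, 7}"
    by (subst prime_factors_product, simp, simp)+ (auto simp: prime_prime_factors)
  then show ?thesis by simp
qed

text \<open>As 1260 = 4 * 9 * 5 * 7, exponents are at most 2 for 2 and 3, and at most 1 for 5 and
  7.\<close>

lemma primepow_dvd_1260:
  assumes "primepow s" "s dvd 1260"
  shows "s \<in> {2, 4, 3, 9, 5, 7 :: nat}"
proof -
  obtain p k where pk: "prime p" "k > 0" "s = p ^ k"
    using assms(1) by (auto simp: primepow_def)
  then have "p dvd 1260"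
    using assms(2) dvd_power dvd_trans by blast
  with pk have p: "p \<in> {2, 3, 5, 7}"
    by (metis in_prime_factors_iff prime_factors_1260 zero_neq_numeral)
  have bound: "k < m" if "\<not> p ^ m dvd 1260" for m
    using that assms(2) pk(3) by (metis dvd_trans le_imp_power_dvd not_le)
  show ?thesis
  proof (cases "p \<in> {2, 3}")
    case True
    then have "\<not> p ^ 3 dvd 1260" by auto
    from bound[OF this] pk(2) have "k = 1 \<or> k = 2" by auto
    with True pk(3) show ?thesis by auto
  next
    case False
    then have "\<not> p ^ 2 dvd 1260" using p by auto
    from bound[OF this] pk(2) have "k = 1" by auto
    with p pk(3) show ?thesis by auto
  qed
qed

section \<open>Verification of (T1), (T2) and the unsupported divisor\<close>

lemma prime_power_divisors_example_set: "prime_power_divisors 1260 example_set = {2, 3, 5}"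
proof (intro equalityI subsetI)
  fix s assume s: "s \<in> prime_power_divisors 1260 example_set"
  then have "s \<in> {2, 4, 3, 9, 5, 7}"
    by (intro primepow_dvd_1260) (auto simp: prime_power_divisors_def)
  moreover have "s \<notin> {4, 9, 7}"
    using s not_cyclotomic_4_dvd_mask_example_set not_cyclotomic_9_dvd_mask_example_set
      not_cyclotomic_7_dvd_mask_example_set by (auto simp: prime_power_divisors_def)
  ultimately show "s \<in> {2, 3, 5}" by auto
next
  fix s :: nat assume "s \<in> {2, 3, 5}"
  then have "prime s" "s dvd 30" "s dvd 1260" "s \<noteq> 1" by auto
  then show "s \<in> prime_power_divisors 1260 example_set"
    by (simp add: prime_power_divisors_def cyclotomic_dvd_mask_example_set)
qed

lemma T1_example_set: "T1 1260 example_set"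
  by (simp add: T1_def prime_power_divisors_example_set card_example_set poly_cyclotomic_prime_1)

text \<open>As 2, 3 and 5 are primes, all exponents are 1, and the product in (T2) is a divisor of
  30 other than 1.\<close>

lemma T2_example_set: "T2 1260 example_set"
  unfolding T2_def prime_power_divisors_example_set
proof (intro allI impI)
  fix P :: "nat set" and e :: "nat \<Rightarrow> nat"
  assume *: "finite P \<and> P \<noteq> {} \<and> (\<forall>p\<in>P. prime p \<and> p ^ e p \<in> {2, 3, 5})"
  have P: "p \<in> {2, 3, 5} \<and> p ^ e p = p" if "p \<in> P" for p
  proof -
    have "p ^ e p \<in> {2, 3, 5}" using * that by blast
    moreover from this have "prime (p ^ e p)" by fastforce
    then have "e p = 1" by (simp add: prime_power_iff)
    ultimately show ?thesis by simp
  qed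
  have "(\<Prod>p\<in>P. p ^ e p) = \<Prod>P"
    using P by (intro prod.cong) auto
  moreover have "\<Prod>P dvd \<Prod>{2, 3, 5}"
    by (rule prod_dvd_prod_subset) (use P in auto)
  moreover have "\<Prod>P \<noteq> 1"
  proof -
    obtain p where "p \<in> P" using * by auto
    then have "p dvd \<Prod>P" using * by (intro dvd_prodI) auto
    with P[OF \<open>p \<in> P\<close>] show ?thesis by auto
  qed
  ultimately show "cyclotomic (\<Prod>p\<in>P. p ^ e p) dvd mask_poly example_set"
    using cyclotomic_dvd_mask_example_set[of "\<Prod>P"] by simp
qed

text \<open>The prime powers exactly dividing 36 are 4 and 9, and both 2 and 3 divide the
  cardinality 30.\<close>

lemma unsupported_divisor_example_set: "unsupported_divisor 1260 example_set 36"
  unfolding unsupported_divisor_def card_example_set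
proof (intro conjI allI impI cyclotomic_36_dvd_mask_example_set)
  have p23: "p \<in> {2, 3}" if "prime p" "p dvd 36" for p :: nat
  proof -
    have "p dvd 2 ^ 2 * 3 ^ 2" using that(2) by simp
    then have "p dvd 2 \<or> p dvd 3"
      using that(1) prime_dvd_mult_iff prime_dvd_power by blast
    then show ?thesis
      using that(1) primes_dvd_imp_eq[of p 2] primes_dvd_imp_eq[of p 3] by auto
  qed
  show "p dvd 30" if "prime p \<and> p dvd 36" for p :: nat
    using p23[of p] that by auto
  fix p a :: nat
  assume *: "prime p \<and> p dvd 36 \<and> p ^ a dvd 36 \<and> \<not> p ^ (a + 1) dvd 36"
  then have p: "p \<in> {2, 3}" using p23 by auto
  then have "p ^ 2 dvd 36" "\<not> p ^ 3 dvd 36" by auto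
  have "a < 3"
    using * \<open>\<not> p ^ 3 dvd 36\<close> by (metis dvd_trans le_imp_power_dvd not_le)
  moreover have "\<not> a + 1 \<le> 2"
    using * \<open>p ^ 2 dvd 36\<close> by (metis dvd_trans le_imp_power_dvd)
  ultimately have "a = 2" by simp
  with p show "\<not> cyclotomic (p ^ a) dvd mask_poly example_set"
    using not_cyclotomic_4_dvd_mask_example_set not_cyclotomic_9_dvd_mask_example_set by auto
qed auto

theorem theorem1p11:
  shows "\<exists>(M :: nat) (A :: nat set).
    M > 0 \<and> A \<noteq> {} \<and> A \<subseteq> {..<M} \<and>
    T1 M A \<and> T2 M A \<and>
    card (prime_factors M) = 4 \<and>
    (\<exists>s. unsupported_divisor M A s)"
proof (intro exI conjI)
  show "example_set \<noteq> {}"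
    using card_example_set by auto
  show "example_set \<subseteq> {..<1260}"
    by (auto simp: example_set_def)
  show "card (prime_factors (1260 :: nat)) = 4"
    by (simp add: prime_factors_1260)
qed (rule T1_example_set T2_example_set unsupported_divisor_example_set | simp)+

end
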